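(* Let $n\in\mathbb N=\{1,2,\ldots\}$ and let $F$ be a subfield of $\mathbb R$. Let $\underline h$ denote the binary operation $(x,y)\mapsto (x+y)/2$. (1) Let $C$ and $C'$ be geometric convex subsets of $F^n$, and assume that $F=\mathbb Q$, or that $C$ and $C'$ have the same affine $F$-dimension and at least one of them is bounded. Then the following are equivalent: the groupoids $(C,\underline h)$ and $(C',\underline h)$ are isomorphic; the affine $F$-space $F^n$ has an automorphism $\psi$ such that $\psi(C)=C'$; the affine real space $\mathbb R^n$ has an automorphism $\psi$ such that $\psi(C)=C'$. (2) If $D$ and $D'$ are isomorphic subalgebras of the groupoid $(\mathbb Q^n,\underline h)$, then $D$ is a geometric convex subset of $\mathbb Q^n$ if and only if $D'$ is a geometric convex subset of $\mathbb Q^n$.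
   Context: A geometric convex subset of $F^n$ is a nonempty set of the form $E\cap F^n$, where $E$ is a convex subset (in the usual sense) of $\mathbb R^n$. Automorphisms of the affine $F$-space $F^n$ are the maps $x\mapsto Ax+b$ with $A$ an invertible $n\times n$ matrix over $F$ and $b\in F^n$ (and similarly with $\mathbb R$ in place of $F$). The affine $F$-dimension of $X\subseteq F^n$ is the dimension of the affine $F$-subspace spanned by $X$. A set $X\subseteq F^n$ is bounded if the set of Euclidean distances between its points is a bounded subset of $\mathbb R$. A groupoid is a set with a binary operation; isomorphisms are bijections preserving the operation. *)

theory Defs
  imports "HOL-Analysis.Analysis"
begin

definition real_subfield :: "real set \<Rightarrow> bool" where
  "real_subfield F \<longleftrightarrow>
     0 \<in> F \<and> 1 \<in> F \<and>
     (\<forall>x\<in>F. \<forall>y\<in>F. x + y \<in> F \<and> x * y \<in> F) \<and>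
     (\<forall>x\<in>F. - x \<in> F \<and> inverse x \<in> F)"

text \<open>The space \<open>F\<^sup>n\<close> is the set of vectors in \<open>real ^ 'n\<close> all of whose coordinates
  lie in \<open>F\<close>; here \<open>n = CARD('n) \<ge> 1\<close>.\<close>

definition vecs :: "real set \<Rightarrow> (real ^ 'n) set" where
  "vecs F = {x. \<forall>i. x $ i \<in> F}"

definition mats :: "real set \<Rightarrow> (real ^ 'n ^ 'n) set" where
  "mats F = {A. \<forall>i j. A $ i $ j \<in> F}"

definition geometric_convex :: "real set \<Rightarrow> (real ^ 'n) set \<Rightarrow> bool" where
  "geometric_convex F C \<longleftrightarrow> C \<noteq> {} \<and> (\<exists>E. convex E \<and> C = E \<inter> vecs F)"

text \<open>Only the values of \<open>\<psi>\<close> on \<open>F\<^sup>n\<close> are relevant. For \<open>F = UNIV\<close> these are the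
  automorphisms of the real affine space.\<close>

definition affine_automorphism :: "real set \<Rightarrow> (real ^ 'n \<Rightarrow> real ^ 'n) \<Rightarrow> bool" where
  "affine_automorphism F \<psi> \<longleftrightarrow>
     (\<exists>A\<in>mats F. \<exists>b\<in>vecs F.
        (\<exists>B\<in>mats F. A ** B = mat 1 \<and> B ** A = mat 1) \<and>
        (\<forall>x\<in>vecs F. \<psi> x = A *v x + b))"

text \<open>Linear and affine notions over the scalars \<open>F\<close>, following the library's
  \<^const>\<open>subspace\<close>, \<^const>\<open>span\<close>, \<^const>\<open>independent\<close>, \<^const>\<open>dim\<close> and
  \<^const>\<open>affine\<close>, which are tied to real scalars.\<close>

definition subspace_over :: "real set \<Rightarrow> (real ^ 'n) set \<Rightarrow> bool" where
  "subspace_over F V \<longleftrightarrow>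
     0 \<in> V \<and> (\<forall>x\<in>V. \<forall>y\<in>V. x + y \<in> V) \<and> (\<forall>c\<in>F. \<forall>x\<in>V. c *\<^sub>R x \<in> V)"

definition span_over :: "real set \<Rightarrow> (real ^ 'n) set \<Rightarrow> (real ^ 'n) set" where
  "span_over F S = subspace_over F hull S"

definition independent_over :: "real set \<Rightarrow> (real ^ 'n) set \<Rightarrow> bool" where
  "independent_over F B \<longleftrightarrow> (\<forall>v\<in>B. v \<notin> span_over F (B - {v}))"

definition dim_over :: "real set \<Rightarrow> (real ^ 'n) set \<Rightarrow> nat" where
  "dim_over F V =
     (if \<exists>B. independent_over F B \<and> span_over F B = span_over F V
      then card (SOME B. independent_over F B \<and> span_over F B = span_over F V) else 0)"

definition affine_over :: "real set \<Rightarrow> (real ^ 'n) set \<Rightarrow> bool" where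
  "affine_over F S \<longleftrightarrow>
     (\<forall>x\<in>S. \<forall>y\<in>S. \<forall>u\<in>F. \<forall>v\<in>F. u + v = 1 \<longrightarrow> u *\<^sub>R x + v *\<^sub>R y \<in> S)"

text \<open>The dimension of an affine space is that of its space of translations, i.e. of
  differences of its points. The value for \<open>X = {}\<close> is the junk value \<open>0\<close>.\<close>

definition aff_dim_over :: "real set \<Rightarrow> (real ^ 'n) set \<Rightarrow> nat" where
  "aff_dim_over F X =
     dim_over F {x - y | x y. x \<in> affine_over F hull X \<and> y \<in> affine_over F hull X}"

text \<open>A groupoid here is a magma: a carrier set closed under a binary operation.\<close>

definition subgroupoid :: "('a \<Rightarrow> 'a \<Rightarrow> 'a) \<Rightarrow> 'a set \<Rightarrow> 'a set \<Rightarrow> bool" where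
  "subgroupoid f D A \<longleftrightarrow> D \<subseteq> A \<and> (\<forall>x\<in>D. \<forall>y\<in>D. f x y \<in> D)"

definition groupoid_isomorphic ::
  "'a set \<Rightarrow> ('a \<Rightarrow> 'a \<Rightarrow> 'a) \<Rightarrow> 'b set \<Rightarrow> ('b \<Rightarrow> 'b \<Rightarrow> 'b) \<Rightarrow> bool" where
  "groupoid_isomorphic A f B g \<longleftrightarrow>
     (\<exists>\<phi>. bij_betw \<phi> A B \<and> (\<forall>x\<in>A. \<forall>y\<in>A. \<phi> (f x y) = g (\<phi> x) (\<phi> y)))"

definition half :: "real ^ 'n \<Rightarrow> real ^ 'n \<Rightarrow> real ^ 'n" where
  "half x y = (1 / 2) *\<^sub>R (x + y)"

end

theory Submission
  imports Defs
begin

text \<open>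
  A midpoint-preserving map is additive along each segment, up to a translation, and a function
  on an interval that is additive wherever this makes sense is \<open>\<rat>\<close>-linear; if moreover it is bounded,
  then it is linear for all scalars (\<open>midpoint_rational\<close>, \<open>midpoint_bounded\<close>). So a groupoid
  isomorphism between geometric convex sets preserves convex combinations with coefficients in
  \<open>F\<close>, provided that \<open>F = \<rat>\<close> or the target is bounded (\<open>midpoint_map_affine\<close>). When only the source
  is bounded, the same argument is applied to the inverse isomorphism.

  An injective map that preserves these combinations is the restriction of an automorphism of the
  affine space \<open>F\<^sup>n\<close> (\<open>affine_embedding_extends\<close>). The idea is to look at the graph of the map, which
  is itself convex over \<open>F\<close>. The non-negative multiples of differences of points of such a set
  form a vector space over \<open>F\<close> (\<open>chords\<close>); for the graph, this vector space is in turn the graph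
  of an injective \<open>F\<close>-linear map between subspaces of \<open>F\<^sup>n\<close>, because a multiple of
  \<open>(x - y, \<phi> x - \<phi> y)\<close> with one component zero is zero. Linear algebra over \<open>F\<close> extends it to an
  invertible matrix. Here independence over \<open>F\<close> and over the reals agree for vectors of \<open>F\<^sup>n\<close>, since
  Cramer's rule keeps the coordinates of a vector of \<open>F\<^sup>n\<close> in \<open>F\<close>
  (\<open>representation_in_subfield\<close>); so real bases can be used throughout.

  All implications follow from this. A real affine automorphism that maps \<open>C\<close> onto \<open>C' \<subseteq> F\<^sup>n\<close> is in
  particular an injective map on \<open>C\<close> that preserves convex combinations over \<open>F\<close>, hence agrees on
  \<open>C\<close> with an automorphism over \<open>F\<close>. In part (2), the isomorphism extends to an automorphism of
  \<open>\<rat>\<^sup>n\<close>, and automorphisms of \<open>\<rat>\<^sup>n\<close> map geometric convex sets to geometric convex sets.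
\<close>

section \<open>Subfields of the reals and matrices over them\<close>

context
  fixes F :: "real set"
  assumes F: "real_subfield F"
begin

lemma subfield_0: "0 \<in> F" and subfield_1: "1 \<in> F"
  using F by (auto simp: real_subfield_def)

lemma subfield_add: "x \<in> F \<Longrightarrow> y \<in> F \<Longrightarrow> x + y \<in> F"
  and subfield_mult: "x \<in> F \<Longrightarrow> y \<in> F \<Longrightarrow> x * y \<in> F"
  and subfield_minus: "x \<in> F \<Longrightarrow> - x \<in> F"
  and subfield_inverse: "x \<in> F \<Longrightarrow> inverse x \<in> F"
  using F by (auto simp: real_subfield_def)

lemma subfield_diff: "x \<in> F \<Longrightarrow> y \<in> F \<Longrightarrow> x - y \<in> F"
  using subfield_add[of x "- y"] subfield_minus[of y] by simp

lemma subfield_divide: "x \<in> F \<Longrightarrow> y \<in> F \<Longrightarrow> x / y \<in> F"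
  using subfield_mult[of x "inverse y"] subfield_inverse[of y] by (simp add: divide_inverse)

lemma subfield_sum: "(\<And>i. i \<in> I \<Longrightarrow> f i \<in> F) \<Longrightarrow> sum f I \<in> F"
  by (induction I rule: infinite_finite_induct) (auto intro: subfield_0 subfield_add)

lemma subfield_prod: "(\<And>i. i \<in> I \<Longrightarrow> f i \<in> F) \<Longrightarrow> prod f I \<in> F"
  by (induction I rule: infinite_finite_induct) (auto intro: subfield_1 subfield_mult)

lemma subfield_of_nat: "of_nat k \<in> F"
  by (induction k) (auto intro: subfield_0 subfield_1 subfield_add)

lemma subfield_of_int: "of_int k \<in> F"
  by (cases k rule: int_cases2) (auto intro: subfield_of_nat subfield_minus)

lemma Rats_subset_subfield: "\<rat> \<subseteq> F"
  by (auto elim!: Rats_cases' intro: subfield_of_int subfield_divide)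

lemma vecs_add: "x \<in> vecs F \<Longrightarrow> y \<in> vecs F \<Longrightarrow> x + y \<in> vecs F"
  and vecs_diff: "x \<in> vecs F \<Longrightarrow> y \<in> vecs F \<Longrightarrow> x - y \<in> vecs F"
  and vecs_scale: "t \<in> F \<Longrightarrow> x \<in> vecs F \<Longrightarrow> t *\<^sub>R x \<in> vecs F"
  by (auto simp: vecs_def intro: subfield_add subfield_diff subfield_mult)

lemma vecs_matrix_vector: "A \<in> mats F \<Longrightarrow> x \<in> vecs F \<Longrightarrow> A *v x \<in> vecs F"
  by (auto simp: vecs_def mats_def matrix_vector_mult_def intro!: subfield_sum subfield_mult)

lemma mats_mult: "A \<in> mats F \<Longrightarrow> B \<in> mats F \<Longrightarrow> A ** B \<in> mats F"
  by (auto simp: mats_def matrix_matrix_mult_def intro!: subfield_sum subfield_mult)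

lemma det_in_subfield: "A \<in> mats F \<Longrightarrow> det A \<in> F"
  unfolding det_def
  by (intro subfield_sum subfield_mult subfield_prod subfield_of_int) (auto simp: mats_def)

text \<open>Cramer's rule writes each coordinate of a solution as a quotient of determinants with
  entries in \<open>F\<close>.\<close>

lemma cramer_in_vecs:
  fixes A :: "real ^ 'n ^ 'n"
  assumes "A \<in> mats F" "invertible A" "A *v x \<in> vecs F"
  shows "x \<in> vecs F"
proof -
  let ?D = "\<lambda>k. (\<chi> i j. if j = k then (A *v x) $ i else A $ i $ j) :: real ^ 'n ^ 'n"
  have "det A \<noteq> 0"
    using assms(2) by (simp add: invertible_det_nz)
  then have "x = (\<chi> k. det (?D k) / det A)"
    using cramer[of A x "A *v x"] by blast
  moreover have "det (?D k) / det A \<in> F" for k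
    using assms by (intro subfield_divide det_in_subfield) (auto simp: mats_def vecs_def)
  ultimately show ?thesis
    by (auto simp: vecs_def vec_eq_iff)
qed

lemma inverse_in_mats:
  fixes A :: "real ^ 'n ^ 'n"
  assumes "A \<in> mats F" "A ** B = mat 1"
  shows "B \<in> mats F"
proof -
  have "column j B \<in> vecs F" for j
  proof (rule cramer_in_vecs[OF assms(1)])
    show "invertible A"
      using assms(2) matrix_left_right_inverse[of A B] unfolding invertible_def by blast
    have "A *v column j B = column j (mat 1)"
      by (metis assms(2) matrix_vector_mul_assoc matrix_vector_mult_basis)
    then show "A *v column j B \<in> vecs F"
      by (auto simp: vecs_def column_def mat_def subfield_0 subfield_1)
  qed
  then show ?thesis
    by (simp add: vecs_def mats_def column_def)
qed

lemma span_vecs: "span (vecs F :: (real ^ 'n) set) = UNIV"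
proof -
  have "Basis \<subseteq> (vecs F :: (real ^ 'n) set)"
    by (auto simp: Basis_vec_def vecs_def axis_def subfield_0 subfield_1)
  then show ?thesis
    using span_mono[of "Basis :: (real ^ 'n) set" "vecs F"] by (auto simp: span_Basis)
qed

lemma extend_to_basis_in_vecs:
  fixes B :: "(real ^ 'n) set"
  assumes "independent B" "B \<subseteq> vecs F"
  obtains B' where "B \<subseteq> B'" "B' \<subseteq> vecs F" "independent B'" "span B' = UNIV"
    "finite B'" "card B' = CARD('n)"
proof -
  obtain B' where B': "B \<subseteq> B'" "B' \<subseteq> vecs F" "independent B'" "vecs F \<subseteq> span B'"
    using maximal_independent_subset_extend[OF assms(2,1)] by blast
  have sp: "span B' = UNIV"
    using span_mono[OF B'(4)] span_vecs by (auto simp: span_span)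
  have "card B' = CARD('n)"
    using dim_eq_card_independent[OF B'(3)] sp dim_span[of B'] by simp
  then show ?thesis
    using that B' sp independent_bound_general by blast
qed

lemma basis_matrix_over_subfield:
  fixes e :: "'n \<Rightarrow> real ^ 'n"
  assumes "bij_betw e UNIV B" "independent B" "B \<subseteq> vecs F"
  obtains M N where "M \<in> mats F" "N \<in> mats F" "M ** N = mat 1" "N ** M = mat 1"
    "\<And>x. M *v x = (\<Sum>j\<in>UNIV. x $ j *\<^sub>R e j)"
proof -
  define M :: "real ^ 'n ^ 'n" where "M = (\<chi> i j. e j $ i)"
  have col: "column j M = e j" for j
    by (simp add: M_def column_def vec_eq_iff)
  have M: "M \<in> mats F"
    using assms(1,3) by (auto simp: M_def mats_def vecs_def bij_betw_def)
  have comb: "M *v x = (\<Sum>j\<in>UNIV. x $ j *\<^sub>R e j)" for x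
    by (simp add: matrix_mult_sum col scalar_mult_eq_scaleR)
  have inj: "inj e" and img: "range e = B"
    using assms(1) by (auto simp: bij_betw_def)
  have "inj ((*v) M)"
  proof (rule linear_injective_0[THEN iffD2, OF matrix_vector_mul_linear], intro allI impI)
    fix x :: "real ^ 'n" assume "M *v x = 0"
    then have "(\<Sum>b\<in>B. x $ (inv e b) *\<^sub>R b) = 0"
      unfolding comb img[symmetric] by (simp add: sum.reindex[OF inj] inv_f_f[OF inj])
    then have "x $ (inv e b) = 0" if "b \<in> B" for b
      using independentD[OF assms(2), of B "\<lambda>b. x $ (inv e b)" b] that img by fastforce
    then show "x = 0"
      using img inj by (metis inv_f_f rangeI vec_eq_iff zero_index)
  qed
  then obtain N where "N ** M = mat 1"
    using matrix_left_invertible_injective[of M] by blast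
  then show ?thesis
    using that[of M N] M comb matrix_left_right_inverse[of N M] inverse_in_mats[OF M] by blast
qed

text \<open>After \<open>B\<close> is extended to a basis inside \<open>F\<^sup>n\<close>, the coordinates of \<open>v\<close> solve a square linear system
  over \<open>F\<close>. Consequently a linear relation over the reals that expresses a vector of \<open>F\<^sup>n\<close> in terms of
  independent vectors of \<open>F\<^sup>n\<close> is already a relation over \<open>F\<close>.\<close>

lemma representation_in_subfield:
  fixes B :: "(real ^ 'n) set"
  assumes "independent B" "B \<subseteq> vecs F" "v \<in> span B" "v \<in> vecs F"
  shows "representation B v b \<in> F"
proof -
  obtain B' where B': "B \<subseteq> B'" "B' \<subseteq> vecs F" "independent B'" "span B' = UNIV"
    "finite B'" "card B' = CARD('n)"
    using extend_to_basis_in_vecs[OF assms(1,2)] .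
  obtain e :: "'n \<Rightarrow> real ^ 'n" where e: "bij_betw e UNIV B'"
    using B' finite_same_card_bij[of "UNIV :: 'n set" B'] by auto
  obtain M N where M: "M \<in> mats F" and N: "N \<in> mats F" and MN: "M ** N = mat 1" "N ** M = mat 1"
    and comb: "\<And>x. M *v x = (\<Sum>j\<in>UNIV. x $ j *\<^sub>R e j)"
    using basis_matrix_over_subfield[OF e B'(3,2)] by blast
  have "M *v (\<chi> j. representation B' v (e j)) = (\<Sum>b\<in>B'. representation B' v b *\<^sub>R b)"
    unfolding comb using sum.reindex_bij_betw[OF e, of "\<lambda>b. representation B' v b *\<^sub>R b"]
    by simp
  also have "\<dots> = v"
    using B' by (intro sum_representation_eq) auto
  finally have "(\<chi> j. representation B' v (e j)) \<in> vecs F"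
    using cramer_in_vecs[OF M] MN assms(4) by (metis invertible_def)
  moreover have "representation B' v b = 0" if "b \<notin> B'"
    using representation_ne_zero that by blast
  moreover have "representation B v = representation B' v"
    using representation_extend[OF B'(3) assms(3) B'(1)] by simp
  moreover have "b \<in> range e" if "b \<in> B'"
    using that e by (auto simp: bij_betw_def)
  ultimately show ?thesis
    by (cases "b \<in> B'") (auto simp: vecs_def subfield_0)
qed

end

section \<open>Convexity and affinity over a subfield\<close>

definition convex_over :: "real set \<Rightarrow> 'a::real_vector set \<Rightarrow> bool" where
  "convex_over F C \<longleftrightarrow>
     (\<forall>x\<in>C. \<forall>y\<in>C. \<forall>t\<in>F. 0 \<le> t \<longrightarrow> t \<le> 1 \<longrightarrow> (1 - t) *\<^sub>R x + t *\<^sub>R y \<in> C)"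

definition affine_map_on ::
  "real set \<Rightarrow> 'a::real_vector set \<Rightarrow> ('a \<Rightarrow> 'b::real_vector) \<Rightarrow> bool" where
  "affine_map_on F C \<phi> \<longleftrightarrow>
     (\<forall>x\<in>C. \<forall>y\<in>C. \<forall>t\<in>F. 0 \<le> t \<longrightarrow> t \<le> 1 \<longrightarrow>
        \<phi> ((1 - t) *\<^sub>R x + t *\<^sub>R y) = (1 - t) *\<^sub>R \<phi> x + t *\<^sub>R \<phi> y)"

text \<open>For a nonempty \<open>C\<close> that is convex over \<open>F\<close>, this is the \<open>F\<close>-vector space of translations of the
  affine \<open>F\<close>-space spanned by \<open>C\<close>. Writing each element with a single difference, instead of as a
  linear combination, makes properties of a map that are known only pointwise on \<open>C\<close> apply
  directly.\<close>

definition chords :: "real set \<Rightarrow> 'a::real_vector set \<Rightarrow> 'a set" where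
  "chords F C = {t *\<^sub>R (x - y) | t x y. t \<in> F \<and> 0 \<le> t \<and> x \<in> C \<and> y \<in> C}"

lemma chordsI: "t \<in> F \<Longrightarrow> 0 \<le> t \<Longrightarrow> x \<in> C \<Longrightarrow> y \<in> C \<Longrightarrow> t *\<^sub>R (x - y) \<in> chords F C"
  by (auto simp: chords_def)

lemma chords_scale:
  assumes "real_subfield F" "c \<in> F" "u \<in> chords F C"
  shows "c *\<^sub>R u \<in> chords F C"
proof -
  obtain t x y where u: "u = t *\<^sub>R (x - y)" "t \<in> F" "0 \<le> t" "x \<in> C" "y \<in> C"
    using assms(3) by (auto simp: chords_def)
  show ?thesis
  proof (cases "0 \<le> c")
    case True
    then show ?thesis
      using chordsI[of "c * t" F x C y] u assms by (simp add: subfield_mult)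
  next
    case False
    then have "((- c) * t) *\<^sub>R (y - x) \<in> chords F C"
      using u assms
      by (intro chordsI) (auto intro!: subfield_mult subfield_minus simp: mult_nonpos_nonneg)
    then show ?thesis
      by (simp add: u(1) scaleR_diff_right)
  qed
qed

text \<open>This is where convexity enters: the coefficients \<open>t\<close> and \<open>s\<close>, divided by their sum, are the weights
  of a convex combination, and the same weights serve for both end points of the chords.\<close>

lemma chords_add:
  assumes F: "real_subfield F" and C: "convex_over F C"
    and "u \<in> chords F C" "v \<in> chords F C"
  shows "u + v \<in> chords F C"
proof -
  obtain t x y where u: "u = t *\<^sub>R (x - y)" "t \<in> F" "0 \<le> t" "x \<in> C" "y \<in> C"
    using assms(3) by (auto simp: chords_def)
  obtain s z w where v: "v = s *\<^sub>R (z - w)" "s \<in> F" "0 \<le> s" "z \<in> C" "w \<in> C"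
    using assms(4) by (auto simp: chords_def)
  show ?thesis
  proof (cases "t + s = 0")
    case True
    then have "u + v = t *\<^sub>R (x - y)"
      using u v by (simp add: add_nonneg_eq_0_iff)
    then show ?thesis
      using u chordsI by metis
  next
    case False
    define r where "r = s / (t + s)"
    have r: "r \<in> F" "0 \<le> r" "r \<le> 1"
      using u v F False
      by (auto simp: r_def divide_simps intro!: subfield_divide subfield_add)
    have m: "(t + s) * (1 - r) = t" "(t + s) * r = s"
      using False by (auto simp: r_def field_simps)
    have "(t + s) *\<^sub>R (((1 - r) *\<^sub>R x + r *\<^sub>R z) - ((1 - r) *\<^sub>R y + r *\<^sub>R w)) \<in> chords F C"
      using u v r C F by (intro chordsI subfield_add) (auto simp: convex_over_def)
    also have "(t + s) *\<^sub>R (((1 - r) *\<^sub>R x + r *\<^sub>R z) - ((1 - r) *\<^sub>R y + r *\<^sub>R w)) = u + v"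
      unfolding u(1) v(1) scaleR_diff_right scaleR_add_right scaleR_scaleR m by simp
    finally show ?thesis .
  qed
qed

lemma chords_0: "real_subfield F \<Longrightarrow> C \<noteq> {} \<Longrightarrow> 0 \<in> chords F C"
  using chordsI[of 0 F _ C] subfield_0[of F] by fastforce

lemma chords_sum:
  assumes "real_subfield F" "convex_over F C" "C \<noteq> {}"
    and "\<And>i. i \<in> I \<Longrightarrow> c i \<in> F" "\<And>i. i \<in> I \<Longrightarrow> u i \<in> chords F C"
  shows "(\<Sum>i\<in>I. c i *\<^sub>R u i) \<in> chords F C"
  using assms(4,5)
  by (induction I rule: infinite_finite_induct)
    (auto intro!: chords_0 chords_add chords_scale assms(1-3))

lemma convex_over_graph:
  assumes "convex_over F C" "affine_map_on F C \<phi>"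
  shows "convex_over F ((\<lambda>x. (x, \<phi> x)) ` C)"
  using assms unfolding convex_over_def affine_map_on_def by (auto simp: image_iff)

lemma chords_graph_iff:
  "(u, v) \<in> chords F ((\<lambda>x. (x, \<phi> x)) ` C) \<longleftrightarrow>
     (\<exists>t x y. t \<in> F \<and> 0 \<le> t \<and> x \<in> C \<and> y \<in> C \<and> u = t *\<^sub>R (x - y) \<and> v = t *\<^sub>R (\<phi> x - \<phi> y))"
  by (auto simp: chords_def) blast+

text \<open>An additive relation is a function as soon as it relates zero to zero only.\<close>

lemma chords_single_valued:
  fixes G :: "('a::real_vector \<times> 'b::real_vector) set"
  assumes F: "real_subfield F" and G: "convex_over F G"
    and zero: "\<And>v. (0, v) \<in> chords F G \<Longrightarrow> v = 0"
    and "(u, v) \<in> chords F G" "(u, w) \<in> chords F G"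
  shows "v = w"
proof -
  have "- 1 *\<^sub>R (u, w) \<in> chords F G"
    using F assms(5) by (intro chords_scale) (auto intro: subfield_minus subfield_1)
  then have "(u, v) + - 1 *\<^sub>R (u, w) \<in> chords F G"
    using chords_add[OF F G] assms(4) by blast
  then show ?thesis
    using zero[of "v - w"] by simp
qed

section \<open>Extending affine embeddings\<close>

lemma graph_chords_comb:
  assumes "real_subfield F" "convex_over F C" "affine_map_on F C \<phi>" "C \<noteq> {}"
    and "\<And>i. i \<in> I \<Longrightarrow> c i \<in> F"
    and "\<And>i. i \<in> I \<Longrightarrow> (u i, v i) \<in> chords F ((\<lambda>x. (x, \<phi> x)) ` C)"
  shows "(\<Sum>i\<in>I. c i *\<^sub>R u i, \<Sum>i\<in>I. c i *\<^sub>R v i) \<in> chords F ((\<lambda>x. (x, \<phi> x)) ` C)"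
proof -
  have "(\<Sum>i\<in>I. c i *\<^sub>R (u i, v i)) \<in> chords F ((\<lambda>x. (x, \<phi> x)) ` C)"
    using assms by (intro chords_sum convex_over_graph) auto
  also have "(\<Sum>i\<in>I. c i *\<^sub>R (u i, v i)) = (\<Sum>i\<in>I. c i *\<^sub>R u i, \<Sum>i\<in>I. c i *\<^sub>R v i)"
    by (simp add: prod_eq_iff fst_sum snd_sum)
  finally show ?thesis .
qed

text \<open>The assumption speaks only of coefficients in \<open>F\<close>, the conclusion of independence over the reals.
  To bridge the two, express a dependent image vector in terms of a real basis \<open>D\<close> chosen among
  the images: by \<open>representation_in_subfield\<close> the coefficients lie in \<open>F\<close>.\<close>

lemma independent_image_if_kernel_over_subfield_trivial:
  fixes B :: "(real ^ 'n) set" and L :: "real ^ 'n \<Rightarrow> real ^ 'n"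
  assumes F: "real_subfield F" and B: "independent B" and LB: "L ` B \<subseteq> vecs F"
    and kernel: "\<And>P c. P \<subseteq> B \<Longrightarrow> (\<And>p. p \<in> P \<Longrightarrow> c p \<in> F) \<Longrightarrow>
      (\<Sum>p\<in>P. c p *\<^sub>R L p) = 0 \<Longrightarrow> (\<Sum>p\<in>P. c p *\<^sub>R p) = 0"
  shows "inj_on L B" "independent (L ` B)"
proof -
  have finB: "finite B"
    using B independent_bound_general by blast
  have zero: "c p = 0"
    if "P \<subseteq> B" "\<And>p. p \<in> P \<Longrightarrow> c p \<in> F" "(\<Sum>p\<in>P. c p *\<^sub>R L p) = 0" "p \<in> P" for P c p
  proof -
    have "finite P" "independent P"
      using that(1) finB B finite_subset independent_mono by blast+
    then show ?thesis
      using independentD[of P P c p] kernel[of P c] that by blast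
  qed
  show inj: "inj_on L B"
  proof (rule inj_onI, rule ccontr)
    fix b b' assume b: "b \<in> B" "b' \<in> B" "L b = L b'" "b \<noteq> b'"
    define c where "c p = (if p = b then 1 else - 1 :: real)" for p
    have "(\<Sum>p\<in>{b, b'}. c p *\<^sub>R L p) = 0"
      using b by (simp add: c_def)
    then have "c b = 0"
      using b F by (intro zero[of "{b, b'}" c]) (auto simp: c_def subfield_1 subfield_minus)
    then show False
      by (simp add: c_def)
  qed
  obtain D where D: "D \<subseteq> L ` B" "independent D" "L ` B \<subseteq> span D"
    using maximal_independent_subset[of "L ` B"] by blast
  have "L ` B \<subseteq> D"
  proof (rule ccontr)
    assume "\<not> L ` B \<subseteq> D"
    then obtain b where b: "b \<in> B" "L b \<notin> D" by blast
    \<comment> \<open>Pull the relation that expresses \<open>L b\<close> through \<open>D\<close> back to a relation among vectors of \<open>B\<close>;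
      its coefficient at \<open>b\<close> itself is \<open>- 1\<close>.\<close>
    define P where "P = {p \<in> B. L p \<in> D}"
    define c where "c p = (if p = b then - 1 else representation D (L b) (L p))" for p
    have P: "P \<subseteq> B" "b \<notin> P" "finite P" "D = L ` P" "inj_on L P"
      using D(1) b finB inj by (auto simp: P_def inj_on_def)
    have "(\<Sum>p\<in>P. c p *\<^sub>R L p) = (\<Sum>p\<in>P. representation D (L b) (L p) *\<^sub>R L p)"
      using P(2) by (intro sum.cong) (auto simp: c_def)
    also have "\<dots> = (\<Sum>w\<in>D. representation D (L b) w *\<^sub>R w)"
      unfolding P(4) by (simp add: sum.reindex[OF P(5)])
    also have "\<dots> = L b"
      using D b P by (intro sum_representation_eq) auto
    finally have "(\<Sum>p\<in>insert b P. c p *\<^sub>R L p) = 0"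
      using P by (simp add: c_def)
    moreover have "representation D (L b) (L p) \<in> F" for p
      using D LB b by (intro representation_in_subfield[OF F]) auto
    then have "c p \<in> F" for p
      using F by (auto simp: c_def subfield_1 subfield_minus)
    ultimately have "c b = 0"
      using P b by (intro zero[of "insert b P" c]) auto
    then show False
      by (simp add: c_def)
  qed
  then show "independent (L ` B)"
    using D independent_mono by blast
qed

text \<open>Extend both \<open>B\<close> and \<open>L ` B\<close> to bases \<open>B'\<close> and \<open>D'\<close> inside \<open>F\<^sup>n\<close>. Since they have equally many new elements,
  \<open>L\<close> extends to a bijection \<open>f\<close> between the bases, and the matrix wanted is the change of basis.\<close>

lemma invertible_matrix_extending:
  fixes B :: "(real ^ 'n) set" and L :: "real ^ 'n \<Rightarrow> real ^ 'n"
  assumes F: "real_subfield F" and B: "independent B" "B \<subseteq> vecs F"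
    and LB: "inj_on L B" "independent (L ` B)" "L ` B \<subseteq> vecs F"
  obtains A A' where "A \<in> mats F" "A' \<in> mats F" "A ** A' = mat 1" "A' ** A = mat 1"
    "\<And>b. b \<in> B \<Longrightarrow> A *v b = L b"
proof -
  obtain B' where B': "B \<subseteq> B'" "B' \<subseteq> vecs F" "independent B'" "finite B'" "card B' = CARD('n)"
    using extend_to_basis_in_vecs[OF F B] by metis
  obtain D' where D': "L ` B \<subseteq> D'" "D' \<subseteq> vecs F" "independent D'" "finite D'"
    "card D' = CARD('n)"
    using extend_to_basis_in_vecs[OF F LB(2,3)] by metis
  have "card (B' - B) = card (D' - L ` B)"
    using B' D' LB(1)
    by (simp add: card_Diff_subset card_image finite_subset[of B B'])
  then obtain g where g: "bij_betw g (B' - B) (D' - L ` B)"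
    using finite_same_card_bij[of "B' - B" "D' - L ` B"] B' D' by auto
  define f where "f b = (if b \<in> B then L b else g b)" for b
  have "bij_betw f B (L ` B)"
    using LB(1) by (auto simp: bij_betw_def f_def inj_on_def)
  moreover have "bij_betw f (B' - B) (D' - L ` B)"
    using g by (rule bij_betw_cong[THEN iffD1, rotated]) (auto simp: f_def)
  ultimately have "bij_betw f (B \<union> (B' - B)) (L ` B \<union> (D' - L ` B))"
    by (intro bij_betw_combine) auto
  then have f: "bij_betw f B' D'"
    using B' D' by (simp add: Un_absorb1)
  obtain e :: "'n \<Rightarrow> real ^ 'n" where e: "bij_betw e UNIV B'"
    using B' finite_same_card_bij[of "UNIV :: 'n set" B'] by auto
  have fe: "bij_betw (f \<circ> e) UNIV D'"
    using bij_betw_trans[OF e f] .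
  obtain M N where M: "M \<in> mats F" "N \<in> mats F" "M ** N = mat 1" "N ** M = mat 1"
    "\<And>x. M *v x = (\<Sum>j\<in>UNIV. x $ j *\<^sub>R e j)"
    using basis_matrix_over_subfield[OF F e B'(3,2)] by blast
  obtain P Q where P: "P \<in> mats F" "Q \<in> mats F" "P ** Q = mat 1" "Q ** P = mat 1"
    "\<And>x. P *v x = (\<Sum>j\<in>UNIV. x $ j *\<^sub>R (f \<circ> e) j)"
    using basis_matrix_over_subfield[OF F fe D'(3,2)] by blast
  show ?thesis
  proof
    show "P ** N \<in> mats F" "M ** Q \<in> mats F"
      using M P by (auto intro: mats_mult[OF F])
    show "(P ** N) ** (M ** Q) = mat 1" "(M ** Q) ** (P ** N) = mat 1"
      using M P by (metis matrix_mul_assoc matrix_mul_rid)+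
    fix b assume b: "b \<in> B"
    then obtain j where j: "b = e j"
      using e B' by (auto simp: bij_betw_def)
    have "M *v axis j 1 = e j" "P *v axis j 1 = f (e j)"
      unfolding M(5) P(5) by (simp_all add: axis_def if_distrib[of "\<lambda>c. c *\<^sub>R _"] cong: if_cong)
    then show "(P ** N) *v b = L b"
      using b j M(4) by (metis f_def matrix_vector_mul_assoc matrix_vector_mul_lid)
  qed
qed

text \<open>Let \<open>G\<close> be the space of chords of the graph of \<open>\<phi>\<close>. It is the graph of an injective \<open>F\<close>-linear map,
  the linear part of \<open>\<phi>\<close>. Its values on a basis \<open>B\<close> taken from \<open>C - a\<close> determine a matrix,
  which then agrees with \<open>\<phi>\<close> on all of \<open>C\<close> because \<open>G\<close> is closed under combinations over \<open>F\<close>.\<close>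

theorem affine_embedding_extends:
  fixes C :: "(real ^ 'n) set" and \<phi> :: "real ^ 'n \<Rightarrow> real ^ 'n"
  assumes F: "real_subfield F" and C: "convex_over F C" "C \<noteq> {}" "C \<subseteq> vecs F"
    and \<phi>: "affine_map_on F C \<phi>" "inj_on \<phi> C" "\<phi> ` C \<subseteq> vecs F"
  obtains \<psi> where "affine_automorphism F \<psi>" "\<And>x. x \<in> C \<Longrightarrow> \<psi> x = \<phi> x"
proof -
  obtain a where a: "a \<in> C" using C by blast
  define G where "G = chords F ((\<lambda>x. (x, \<phi> x)) ` C)"
  define L where "L b = \<phi> (a + b) - \<phi> a" for b
  obtain B where B: "B \<subseteq> (\<lambda>x. x - a) ` C" "independent B" "(\<lambda>x. x - a) ` C \<subseteq> span B"
    using maximal_independent_subset by blast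
  have BC: "a + b \<in> C" if "b \<in> B" for b
    using that B(1) by auto
  have BF: "B \<subseteq> vecs F"
    using B(1) C(3) a by (auto intro!: vecs_diff[OF F])
  have LF: "L ` B \<subseteq> vecs F"
    using BC a \<phi>(3) by (auto simp: L_def intro!: vecs_diff[OF F])
  have chord: "(x - a, \<phi> x - \<phi> a) \<in> G" if "x \<in> C" for x
    unfolding G_def chords_graph_iff
    by (rule exI[of _ 1], rule exI[of _ x], rule exI[of _ a]) (use that a F in \<open>simp add: subfield_1\<close>)
  have comb: "(\<Sum>p\<in>P. c p *\<^sub>R p, \<Sum>p\<in>P. c p *\<^sub>R L p) \<in> G"
    if "P \<subseteq> B" "\<And>p. p \<in> P \<Longrightarrow> c p \<in> F" for P c
    unfolding G_def
  proof (rule graph_chords_comb[OF F C(1) \<phi>(1) C(2)])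
    show "(p, L p) \<in> chords F ((\<lambda>x. (x, \<phi> x)) ` C)" if "p \<in> P" for p
      using chord[OF BC[of p]] that \<open>P \<subseteq> B\<close> by (auto simp: G_def L_def)
  qed (use that in blast)
  have kernel: "u = 0" if "(u, 0) \<in> G" for u
    using that \<phi>(2) unfolding G_def chords_graph_iff by (auto simp: inj_on_def)
  have zero: "v = 0" if "(0, v) \<in> G" for v
    using that unfolding G_def chords_graph_iff by auto
  have single_valued: "v = w" if "(u, v) \<in> G" "(u, w) \<in> G" for u v w
    using chords_single_valued[OF F convex_over_graph[OF C(1) \<phi>(1)]] zero that
    unfolding G_def by blast
  have "(\<Sum>p\<in>P. c p *\<^sub>R p) = 0"
    if "P \<subseteq> B" "\<And>p. p \<in> P \<Longrightarrow> c p \<in> F" "(\<Sum>p\<in>P. c p *\<^sub>R L p) = 0" for P c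
    using comb[of P c, OF that(1,2)] unfolding that(3) by (rule kernel)
  note LB = independent_image_if_kernel_over_subfield_trivial[OF F B(2) LF this]
  obtain A A' where A: "A \<in> mats F" "A' \<in> mats F" "A ** A' = mat 1" "A' ** A = mat 1"
    "\<And>b. b \<in> B \<Longrightarrow> A *v b = L b"
    using invertible_matrix_extending[OF F B(2) BF LB LF] by blast
  have ext: "A *v (x - a) = \<phi> x - \<phi> a" if x: "x \<in> C" for x
  proof -
    define c where "c = representation B (x - a)"
    have xa: "x - a \<in> span B" "x - a \<in> vecs F"
      using x a B(3) C(3) by (auto intro!: vecs_diff[OF F])
    have c: "c p \<in> F" for p
      unfolding c_def using representation_in_subfield[OF F B(2) BF xa] .
    have "finite B" using B(2) independent_bound_general by blast
    then have xc: "(\<Sum>p\<in>B. c p *\<^sub>R p) = x - a"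
      unfolding c_def using xa B(2) by (intro sum_representation_eq) auto
    have "A *v (x - a) = (\<Sum>p\<in>B. c p *\<^sub>R L p)"
      unfolding xc[symmetric] using A(5)
      by (simp add: linear_sum[OF matrix_vector_mul_linear] matrix_vector_mult_scaleR)
    moreover have "(x - a, \<Sum>p\<in>B. c p *\<^sub>R L p) \<in> G"
      using comb[of B c] c xc by simp
    ultimately show ?thesis
      using single_valued chord[OF x] by metis
  qed
  show ?thesis
  proof
    have "\<phi> a - A *v a \<in> vecs F"
      using a C(3) \<phi>(3) A(1) by (auto intro!: vecs_diff[OF F] vecs_matrix_vector[OF F])
    then show "affine_automorphism F (\<lambda>x. A *v x + (\<phi> a - A *v a))"
      using A unfolding affine_automorphism_def by blast
    show "A *v x + (\<phi> a - A *v a) = \<phi> x" if "x \<in> C" for x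
      using ext[OF that] by (simp add: matrix_vector_mult_diff_distrib algebra_simps)
  qed
qed

section \<open>Midpoint-preserving maps\<close>

text \<open>In what follows \<open>h\<close> is a midpoint-preserving function on the unit interval of \<open>F\<close>, normalised at zero.
  Taking the midpoint with zero gives \<open>h (s / 2) = h s / 2\<close>, so that midpoint preservation becomes
  additivity.\<close>

context
  fixes F :: "real set" and h :: "real \<Rightarrow> 'a::real_normed_vector"
  assumes F: "real_subfield F"
    and midpoint: "\<And>s t. s \<in> F \<inter> {0..1} \<Longrightarrow> t \<in> F \<inter> {0..1} \<Longrightarrow>
      h ((s + t) / 2) = (1/2) *\<^sub>R (h s + h t)"
    and zero: "h 0 = 0"
begin

lemma midpoint_add:
  assumes "s \<in> F" "t \<in> F" "0 \<le> s" "0 \<le> t" "s + t \<le> 1"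
  shows "h (s + t) = h s + h t"
proof -
  have "(1/2) *\<^sub>R h (s + t) = h ((s + t) / 2)"
    using midpoint[of "s + t" 0] assms zero F by (simp add: subfield_0 subfield_add)
  also have "\<dots> = (1/2) *\<^sub>R (h s + h t)"
    using midpoint[of s t] assms by simp
  finally show ?thesis by simp
qed

lemma midpoint_multiple:
  assumes "t \<in> F" "0 \<le> t" "real k * t \<le> 1"
  shows "h (real k * t) = real k *\<^sub>R h t"
  using assms(3)
proof (induction k)
  case 0
  then show ?case by (simp add: zero)
next
  case (Suc k)
  have le: "real k * t + t \<le> 1"
    using Suc.prems by (simp add: algebra_simps)
  then have "h (real k * t + t) = h (real k * t) + h t"
    using assms F by (intro midpoint_add) (auto simp: subfield_mult subfield_of_nat)
  then show ?case
    using Suc.IH le assms(2) by (simp add: algebra_simps)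
qed

lemma midpoint_rational:
  assumes "t \<in> \<rat>" "0 \<le> t" "t \<le> 1"
  shows "h t = t *\<^sub>R h 1"
proof -
  obtain p q :: nat where pq: "q \<noteq> 0" "t = real p / real q"
    using Rats_abs_nat_div_natE[OF assms(1)] assms(2) by (metis abs_of_nonneg)
  have F1: "1 / real q \<in> F"
    using F by (auto intro: subfield_divide subfield_1 subfield_of_nat)
  have "h 1 = real q *\<^sub>R h (1 / real q)"
    using midpoint_multiple[OF F1, of q] pq by simp
  moreover have "h t = real p *\<^sub>R h (1 / real q)"
    using midpoint_multiple[OF F1, of p] pq assms by simp
  ultimately show ?thesis
    using pq by simp
qed

text \<open>Subtract from \<open>t\<close> the largest fraction \<open>r\<close> with denominator \<open>n\<close> below it. At \<open>r\<close> the function is already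
  linear, so the error at \<open>t\<close> equals the error at \<open>s = t - r\<close>. As \<open>n * s\<close> still lies in the unit
  interval, \<open>n\<close> times this error is bounded independently of \<open>n\<close>, hence the error vanishes.\<close>

lemma midpoint_bounded:
  assumes bdd: "bounded (h ` (F \<inter> {0..1}))" and t: "t \<in> F" "0 \<le> t" "t \<le> 1"
  shows "h t = t *\<^sub>R h 1"
proof (rule ccontr)
  assume ne: "h t \<noteq> t *\<^sub>R h 1"
  obtain K where K: "\<And>s. s \<in> F \<Longrightarrow> 0 \<le> s \<Longrightarrow> s \<le> 1 \<Longrightarrow> norm (h s) \<le> K"
    using bdd unfolding bounded_iff by force
  define d where "d = norm (h t - t *\<^sub>R h 1)"
  have "d > 0" using ne by (simp add: d_def)
  then obtain n :: nat where n: "K + norm (h 1) < real n * d"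
    using reals_Archimedean3 by blast
  have "0 \<le> K"
    using K[of 0] F by (auto simp: zero subfield_0)
  then have "n \<noteq> 0"
    using n by (intro notI) (simp, smt (verit) norm_ge_zero)
  then have n0: "real n > 0" by simp
  define r where "r = real_of_int \<lfloor>real n * t\<rfloor> / real n"
  define s where "s = t - r"
  have nr: "real n * r = real_of_int \<lfloor>real n * t\<rfloor>"
    using n0 by (simp add: r_def)
  have rQ: "r \<in> \<rat>" by (simp add: r_def)
  have r0: "0 \<le> r" using n0 t by (simp add: r_def)
  have "real n * r \<le> real n * t" unfolding nr by simp
  then have s0: "0 \<le> s" using n0 by (simp add: s_def)
  have ns: "real n * s \<le> 1"
    using nr by (simp add: s_def right_diff_distrib) linarith
  have rF: "r \<in> F" using rQ Rats_subset_subfield[OF F] by blast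
  have sF: "s \<in> F" using rF t F by (simp add: s_def subfield_diff)
  have "h (r + s) = h r + h s"
    using r0 s0 rF sF t by (intro midpoint_add) (auto simp: s_def)
  moreover have "h r = r *\<^sub>R h 1"
    using s0 t r0 rQ by (intro midpoint_rational) (auto simp: s_def)
  ultimately have diff: "h t - t *\<^sub>R h 1 = h s - s *\<^sub>R h 1"
    by (simp add: s_def algebra_simps)
  then have "real n *\<^sub>R (h t - t *\<^sub>R h 1) = h (real n * s) - (real n * s) *\<^sub>R h 1"
    by (simp only: diff midpoint_multiple[OF sF s0 ns] scaleR_diff_right scaleR_scaleR)
  moreover have "norm (h (real n * s) - (real n * s) *\<^sub>R h 1) \<le> K + 1 * norm (h 1)"
  proof (rule order.trans[OF norm_triangle_ineq4 add_mono])
    show "norm (h (real n * s)) \<le> K"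
      using s0 ns sF F by (intro K) (auto simp: subfield_mult subfield_of_nat)
    show "norm ((real n * s) *\<^sub>R h 1) \<le> 1 * norm (h 1)"
      using s0 ns mult_right_mono[OF ns, of "norm (h 1)"] by simp
  qed
  ultimately have "norm (real n *\<^sub>R (h t - t *\<^sub>R h 1)) \<le> K + norm (h 1)"
    by simp
  then show False
    using n by (simp add: d_def)
qed

end

lemma midpoint_map_affine:
  fixes C :: "(real ^ 'n) set" and \<phi> :: "real ^ 'n \<Rightarrow> real ^ 'n"
  assumes F: "real_subfield F" and C: "convex_over F C"
    and mid: "\<And>x y. x \<in> C \<Longrightarrow> y \<in> C \<Longrightarrow> \<phi> (half x y) = half (\<phi> x) (\<phi> y)"
    and reg: "F = \<rat> \<or> bounded (\<phi> ` C)"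
  shows "affine_map_on F C \<phi>"
  unfolding affine_map_on_def
proof (intro ballI impI)
  fix x y t assume xy: "x \<in> C" "y \<in> C" and t: "t \<in> F" "0 \<le> t" "t \<le> 1"
  define p where "p s = (1 - s) *\<^sub>R x + s *\<^sub>R y" for s
  define h where "h s = \<phi> (p s) - \<phi> x" for s
  have pC: "p s \<in> C" if "s \<in> F \<inter> {0..1}" for s
    using that C xy by (auto simp: p_def convex_over_def)
  have "h ((s + u) / 2) = (1/2) *\<^sub>R (h s + h u)" if "s \<in> F \<inter> {0..1}" "u \<in> F \<inter> {0..1}" for s u
  proof -
    have "p ((s + u) / 2) = half (p s) (p u)"
      by (simp add: p_def half_def vec_eq_iff field_simps)
    then have "h ((s + u) / 2) = half (\<phi> (p s)) (\<phi> (p u)) - \<phi> x"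
      using mid pC that by (simp add: h_def)
    also have "\<dots> = (1/2) *\<^sub>R (h s + h u)"
      by (simp add: h_def half_def vec_eq_iff field_simps)
    finally show ?thesis .
  qed
  note midh = this
  have h0: "h 0 = 0"
    by (simp add: h_def p_def)
  have "h t = t *\<^sub>R h 1"
    using reg
  proof
    assume "F = \<rat>"
    then show ?thesis
      using midpoint_rational[OF F midh h0] t by blast
  next
    assume "bounded (\<phi> ` C)"
    then have "bounded ((\<lambda>v. - \<phi> x + v) ` \<phi> ` C)"
      by (rule bounded_translation)
    then have "bounded (h ` (F \<inter> {0..1}))"
      by (rule bounded_subset) (use pC in \<open>auto simp: h_def image_image\<close>)
    then show ?thesis
      using midpoint_bounded[OF F midh h0] t by blast
  qed
  then show "\<phi> ((1 - t) *\<^sub>R x + t *\<^sub>R y) = (1 - t) *\<^sub>R \<phi> x + t *\<^sub>R \<phi> y"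
    by (simp add: h_def p_def algebra_simps)
qed

section \<open>Geometric convex sets and affine automorphisms\<close>

lemma geometric_convex_imp_convex_over:
  assumes "real_subfield F" "geometric_convex F C"
  shows "convex_over F C" "C \<noteq> {}" "C \<subseteq> vecs F"
proof -
  obtain E where E: "convex E" "C = E \<inter> vecs F" and ne: "C \<noteq> {}"
    using assms(2) by (auto simp: geometric_convex_def)
  show "convex_over F C"
    unfolding convex_over_def E(2)
    using E(1) assms(1)
    by (auto simp: convex_alt intro!: vecs_add vecs_scale subfield_diff subfield_1)
  show "C \<noteq> {}" "C \<subseteq> vecs F" using E ne by auto
qed

lemma half_in_convex_over:
  assumes "real_subfield F" "convex_over F C" "x \<in> C" "y \<in> C"
  shows "half x y \<in> C"
proof -
  have "1/2 \<in> F"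
    using Rats_subset_subfield[OF assms(1)] by auto
  then have "(1 - 1/2) *\<^sub>R x + (1/2) *\<^sub>R y \<in> C"
    using assms(2-4) unfolding convex_over_def by fastforce
  then show ?thesis
    by (simp add: half_def scaleR_add_right)
qed

lemma affine_automorphismE:
  assumes F: "real_subfield F" and "affine_automorphism F \<psi>"
  obtains A A' b where "A \<in> mats F" "A' \<in> mats F" "b \<in> vecs F" "A ** A' = mat 1"
    "A' ** A = mat 1" "\<And>x. x \<in> vecs F \<Longrightarrow> \<psi> x = A *v x + b"
    "\<And>x. A' *v (A *v x + b - b) = x"
proof -
  obtain A A' b where *: "A \<in> mats F" "A' \<in> mats F" "b \<in> vecs F" "A ** A' = mat 1"
    "A' ** A = mat 1" "\<And>x. x \<in> vecs F \<Longrightarrow> \<psi> x = A *v x + b"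
    using assms(2) unfolding affine_automorphism_def by blast
  then show ?thesis
    using that[OF *] by (simp add: matrix_vector_mul_assoc)
qed

lemma affine_automorphism_inverse:
  assumes F: "real_subfield F" and \<psi>: "affine_automorphism F \<psi>" and C: "C \<subseteq> vecs F"
  obtains \<psi>' where "affine_automorphism F \<psi>'" "\<psi>' ` \<psi> ` C = C"
proof -
  obtain A A' b where A: "A \<in> mats F" "A' \<in> mats F" "b \<in> vecs F" "A ** A' = mat 1"
    "A' ** A = mat 1" "\<And>x. x \<in> vecs F \<Longrightarrow> \<psi> x = A *v x + b"
    "\<And>x. A' *v (A *v x + b - b) = x"
    using affine_automorphismE[OF F \<psi>] by metis
  have "- 1 *\<^sub>R (A' *v b) \<in> vecs F"
    using A F by (intro vecs_scale vecs_matrix_vector) (auto simp: subfield_1 subfield_minus)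
  moreover have "A' *v (y - b) = A' *v y + - 1 *\<^sub>R (A' *v b)" for y
    by (simp add: matrix_vector_mult_diff_distrib)
  ultimately have "affine_automorphism F (\<lambda>y. A' *v (y - b))"
    using A(1,2,4,5) unfolding affine_automorphism_def by blast
  moreover have "(\<lambda>y. A' *v (y - b)) ` \<psi> ` C = C"
    using A(6,7) C unfolding image_image by (auto simp: subset_iff image_iff)
  ultimately show ?thesis
    using that by blast
qed

lemma affine_automorphism_isomorphism:
  assumes F: "real_subfield F" and \<psi>: "affine_automorphism F \<psi>"
    and C: "convex_over F C" "C \<subseteq> vecs F"
  shows "groupoid_isomorphic C half (\<psi> ` C) half"
proof -
  obtain A A' b where A: "\<And>x. x \<in> vecs F \<Longrightarrow> \<psi> x = A *v x + b"
    "\<And>x. A' *v (A *v x + b - b) = x"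
    using affine_automorphismE[OF F \<psi>] by metis
  have "inj_on \<psi> C"
    using A C(2) by (metis inj_onI subsetD)
  moreover have "\<psi> (half x y) = half (\<psi> x) (\<psi> y)" if "x \<in> C" "y \<in> C" for x y
  proof -
    have "\<psi> (half x y) = A *v half x y + b" "\<psi> x = A *v x + b" "\<psi> y = A *v y + b"
      using A(1) C(2) that half_in_convex_over[OF F C(1) that] by blast+
    then show ?thesis
      by (simp only:)
        (simp add: half_def matrix_vector_mult_scaleR matrix_vector_right_distrib
          vec_eq_iff field_simps)
  qed
  ultimately show ?thesis
    unfolding groupoid_isomorphic_def bij_betw_def by blast
qed

text \<open>If \<open>C = E \<inter> F\<^sup>n\<close>, then the real extension of \<open>\<psi>\<close> maps \<open>E\<close> to a convex set that cuts out the image of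
  \<open>C\<close>: both \<open>\<psi>\<close> and its inverse preserve \<open>F\<^sup>n\<close>, so no further points of \<open>F\<^sup>n\<close> can arise.\<close>

lemma geometric_convex_automorphic_image:
  assumes F: "real_subfield F" and \<psi>: "affine_automorphism F \<psi>" and C: "geometric_convex F C"
  shows "geometric_convex F (\<psi> ` C)"
proof -
  obtain A A' b where A: "A \<in> mats F" "A' \<in> mats F" "b \<in> vecs F"
    "\<And>x. x \<in> vecs F \<Longrightarrow> \<psi> x = A *v x + b" "\<And>x. A' *v (A *v x + b - b) = x"
    using affine_automorphismE[OF F \<psi>] by metis
  obtain E where E: "convex E" "C = E \<inter> vecs F" and ne: "C \<noteq> {}"
    using C by (auto simp: geometric_convex_def)
  have "\<psi> ` C = (\<lambda>x. A *v x + b) ` E \<inter> vecs F"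
  proof (intro equalityI subsetI)
    fix y assume "y \<in> \<psi> ` C"
    then show "y \<in> (\<lambda>x. A *v x + b) ` E \<inter> vecs F"
      using A E(2) F by (auto intro!: vecs_add vecs_matrix_vector)
  next
    fix y assume "y \<in> (\<lambda>x. A *v x + b) ` E \<inter> vecs F"
    then obtain x where x: "x \<in> E" "y = A *v x + b" and y: "y \<in> vecs F" by blast
    have "A' *v (y - b) \<in> vecs F"
      using A y F by (intro vecs_matrix_vector vecs_diff)
    then have "x \<in> C"
      using x A(5) E(2) by simp
    then show "y \<in> \<psi> ` C"
      using A(4) x(2) E(2) by (auto intro!: image_eqI[of _ _ x])
  qed
  moreover have "convex ((\<lambda>x. A *v x + b) ` E)"
  proof -
    have "(\<lambda>x. A *v x + b) ` E = (\<lambda>y. b + y) ` ((*v) A) ` E"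
      by (auto simp: image_image add.commute)
    then show ?thesis
      using E(1) by (simp add: convex_translation convex_linear_image matrix_vector_mul_linear)
  qed
  ultimately show ?thesis
    using ne unfolding geometric_convex_def by blast
qed

lemma groupoid_isomorphic_sym:
  assumes "groupoid_isomorphic A f B g" and closed: "\<And>x y. x \<in> A \<Longrightarrow> y \<in> A \<Longrightarrow> f x y \<in> A"
  shows "groupoid_isomorphic B g A f"
proof -
  obtain \<phi> where \<phi>: "bij_betw \<phi> A B" "\<And>x y. x \<in> A \<Longrightarrow> y \<in> A \<Longrightarrow> \<phi> (f x y) = g (\<phi> x) (\<phi> y)"
    using assms(1) unfolding groupoid_isomorphic_def by blast
  let ?i = "inv_into A \<phi>"
  have i: "?i x \<in> A" "\<phi> (?i x) = x" if "x \<in> B" for x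
    using \<phi>(1) that by (auto simp: bij_betw_def inv_into_into f_inv_into_f)
  have "?i (g x y) = f (?i x) (?i y)" if "x \<in> B" "y \<in> B" for x y
    using \<phi>(2)[of "?i x" "?i y"] i that closed \<phi>(1) by (metis bij_betw_inv_into_left)
  then show ?thesis
    unfolding groupoid_isomorphic_def using bij_betw_inv_into[OF \<phi>(1)] by blast
qed

lemma isomorphism_imp_automorphism:
  fixes C C' :: "(real ^ 'n) set"
  assumes F: "real_subfield F" and C: "convex_over F C" "C \<noteq> {}" "C \<subseteq> vecs F"
    and C': "C' \<subseteq> vecs F" and reg: "F = \<rat> \<or> bounded C'"
    and iso: "groupoid_isomorphic C half C' half"
  obtains \<psi> where "affine_automorphism F \<psi>" "\<psi> ` C = C'"
proof -
  obtain \<phi> where \<phi>: "bij_betw \<phi> C C'"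
    "\<And>x y. x \<in> C \<Longrightarrow> y \<in> C \<Longrightarrow> \<phi> (half x y) = half (\<phi> x) (\<phi> y)"
    using iso unfolding groupoid_isomorphic_def by blast
  have img: "\<phi> ` C = C'" and inj: "inj_on \<phi> C"
    using \<phi>(1) by (auto simp: bij_betw_def)
  have "affine_map_on F C \<phi>"
    using midpoint_map_affine[OF F C(1) \<phi>(2)] reg img by blast
  then obtain \<psi> where "affine_automorphism F \<psi>" "\<And>x. x \<in> C \<Longrightarrow> \<psi> x = \<phi> x"
    using affine_embedding_extends[OF F C _ inj] C' img by blast
  then show ?thesis
    using that[of \<psi>] img by (metis image_cong)
qed

text \<open>The matrix of \<open>\<psi>\<close> need not have entries in \<open>F\<close>, since \<open>C\<close> may span a proper subspace only. The
  automorphism over \<open>F\<close> is therefore constructed anew from the restriction of \<open>\<psi>\<close> to \<open>C\<close>.\<close>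

lemma automorphism_restrict_scalars:
  fixes C C' :: "(real ^ 'n) set"
  assumes F: "real_subfield F" and C: "convex_over F C" "C \<noteq> {}" "C \<subseteq> vecs F"
    and \<psi>: "affine_automorphism UNIV \<psi>" and img: "\<psi> ` C \<subseteq> vecs F"
  obtains \<psi>' where "affine_automorphism F \<psi>'" "\<psi>' ` C = \<psi> ` C"
proof -
  have R: "real_subfield UNIV"
    by (simp add: real_subfield_def)
  obtain A A' b where A: "\<And>x. x \<in> vecs UNIV \<Longrightarrow> \<psi> x = A *v x + b"
    "\<And>x. A' *v (A *v x + b - b) = x"
    using affine_automorphismE[OF R \<psi>] by metis
  have A1: "\<psi> x = A *v x + b" for x
    using A(1) by (simp add: vecs_def)
  have "inj_on \<psi> C"
    using A1 A(2) by (metis inj_onI)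
  moreover have "affine_map_on F C \<psi>"
    unfolding affine_map_on_def A1
    by (auto simp: matrix_vector_mult_scaleR matrix_vector_right_distrib algebra_simps)
  ultimately obtain \<psi>' where "affine_automorphism F \<psi>'" "\<And>x. x \<in> C \<Longrightarrow> \<psi>' x = \<psi> x"
    using affine_embedding_extends[OF F C] img by blast
  then show ?thesis
    using that[of \<psi>'] by (metis image_cong)
qed

lemma automorphism_extend_scalars:
  assumes "affine_automorphism F \<psi>" "C \<subseteq> vecs F"
  obtains \<psi>' where "affine_automorphism UNIV \<psi>'" "\<psi>' ` C = \<psi> ` C"
proof -
  obtain A A' b where A: "A ** A' = mat 1" "A' ** A = mat 1"
    "\<And>x. x \<in> vecs F \<Longrightarrow> \<psi> x = A *v x + b"
    using assms(1) unfolding affine_automorphism_def by blast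
  have "affine_automorphism UNIV (\<lambda>x. A *v x + b)"
    using A(1,2) unfolding affine_automorphism_def by (auto simp: mats_def vecs_def)
  moreover have "(\<lambda>x. A *v x + b) ` C = \<psi> ` C"
    using A(3) assms(2) by (intro image_cong) auto
  ultimately show ?thesis
    using that by blast
qed

text \<open>Convexity of \<open>D\<close> makes the isomorphism extend to an automorphism of \<open>\<rat>\<^sup>n\<close>, which then transports
  geometric convexity to \<open>D'\<close>.\<close>

lemma geometric_convex_isomorphic_rational:
  fixes D D' :: "(real ^ 'n) set"
  assumes "geometric_convex \<rat> D" "D' \<subseteq> vecs \<rat>" "groupoid_isomorphic D half D' half"
  shows "geometric_convex \<rat> D'"
proof -
  have Q: "real_subfield \<rat>"
    by (simp add: real_subfield_def)
  obtain \<psi> where "affine_automorphism \<rat> \<psi>" "\<psi> ` D = D'"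
    using isomorphism_imp_automorphism[OF Q geometric_convex_imp_convex_over[OF Q assms(1)]] assms
    by blast
  then show ?thesis
    using geometric_convex_automorphic_image[OF Q _ assms(1)] by blast
qed

theorem corollary2p5:
  fixes F :: "real set"
  assumes "real_subfield F"
  shows
    "(\<forall>(C :: (real ^ 'n) set) (C' :: (real ^ 'n) set).
        geometric_convex F C \<longrightarrow> geometric_convex F C' \<longrightarrow>
        (F = \<rat> \<or> (aff_dim_over F C = aff_dim_over F C' \<and> (bounded C \<or> bounded C'))) \<longrightarrow>
        (groupoid_isomorphic C half C' half \<longleftrightarrow>
           (\<exists>\<psi>. affine_automorphism F \<psi> \<and> \<psi> ` C = C')) \<and>
        ((\<exists>\<psi>. affine_automorphism F \<psi> \<and> \<psi> ` C = C') \<longleftrightarrow>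
           (\<exists>\<psi>. affine_automorphism UNIV \<psi> \<and> \<psi> ` C = C')))
     \<and>
     (\<forall>(D :: (real ^ 'n) set) (D' :: (real ^ 'n) set).
        subgroupoid half D (vecs \<rat>) \<longrightarrow> subgroupoid half D' (vecs \<rat>) \<longrightarrow>
        groupoid_isomorphic D half D' half \<longrightarrow>
        (geometric_convex \<rat> D \<longleftrightarrow> geometric_convex \<rat> D'))"
proof (rule conjI; intro allI impI)
  fix C C' :: "(real ^ 'n) set"
  assume gC: "geometric_convex F C" and gC': "geometric_convex F C'"
    and reg: "F = \<rat> \<or> (aff_dim_over F C = aff_dim_over F C' \<and> (bounded C \<or> bounded C'))"
  note F = assms
  note C = geometric_convex_imp_convex_over[OF F gC]
    and C' = geometric_convex_imp_convex_over[OF F gC']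
  have iso_auto: "\<exists>\<psi>. affine_automorphism F \<psi> \<and> \<psi> ` C = C'"
    if iso: "groupoid_isomorphic C half C' half"
  proof (cases "F = \<rat> \<or> bounded C'")
    case True
    then show ?thesis
      using isomorphism_imp_automorphism[OF F C C'(3) _ iso] by blast
  next
    case False
    \<comment> \<open>Now the source is bounded, so the inverse isomorphism extends to an automorphism.\<close>
    then have "bounded C" using reg by blast
    moreover have "groupoid_isomorphic C' half C half"
      using groupoid_isomorphic_sym[OF iso] half_in_convex_over[OF F C(1)] by blast
    ultimately obtain \<psi> where "affine_automorphism F \<psi>" "\<psi> ` C' = C"
      using isomorphism_imp_automorphism[OF F C' C(3)] by blast
    then show ?thesis
      using affine_automorphism_inverse[OF F _ C'(3)] by metis
  qed
  have auto_iso: "groupoid_isomorphic C half C' half"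
    if "affine_automorphism F \<psi>" "\<psi> ` C = C'" for \<psi>
    using affine_automorphism_isomorphism[OF F that(1) C(1,3)] that(2) by simp
  have extend: "\<exists>\<psi>. affine_automorphism UNIV \<psi> \<and> \<psi> ` C = C'"
    if "affine_automorphism F \<psi>" "\<psi> ` C = C'" for \<psi>
    using automorphism_extend_scalars[OF that(1) C(3)] that(2) by metis
  have restrict: "\<exists>\<psi>. affine_automorphism F \<psi> \<and> \<psi> ` C = C'"
    if "affine_automorphism UNIV \<psi>" "\<psi> ` C = C'" for \<psi>
    using automorphism_restrict_scalars[OF F C that(1)] that(2) C'(3) by metis
  show "(groupoid_isomorphic C half C' half \<longleftrightarrow>
           (\<exists>\<psi>. affine_automorphism F \<psi> \<and> \<psi> ` C = C')) \<and>
        ((\<exists>\<psi>. affine_automorphism F \<psi> \<and> \<psi> ` C = C') \<longleftrightarrow>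
           (\<exists>\<psi>. affine_automorphism UNIV \<psi> \<and> \<psi> ` C = C'))"
    using iso_auto auto_iso extend restrict by blast
next
  fix D D' :: "(real ^ 'n) set"
  assume D: "subgroupoid half D (vecs \<rat>)" "subgroupoid half D' (vecs \<rat>)"
    and iso: "groupoid_isomorphic D half D' half"
  have "groupoid_isomorphic D' half D half"
    using groupoid_isomorphic_sym[OF iso] D(1) unfolding subgroupoid_def by blast
  then show "geometric_convex \<rat> D \<longleftrightarrow> geometric_convex \<rat> D'"
    using geometric_convex_isomorphic_rational iso D unfolding subgroupoid_def by blast
qed

end
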